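(* The conjunction of the statements $(A)$ and $(B)$ is equivalent to the statement $( ** )$.
   Context: $S^2_1=\{\alpha<\omega_2:\mathrm{cf}(\alpha)=\omega_1\}$. An ordinal $\beta$ is closed under $h$ if $h(\alpha)<\beta$ for all $\alpha<\beta$. $(A)$ is the statement: for any family $\mathcal C$ of at most $\omega_2$-many club subsets of $\omega_1$, there exists a club $E\subseteq\omega_1$ such that for all $C\in\mathcal C$, $E\setminus C$ is countable. $(B)$ is the statement: there exists a sequence $\vec\pi=\langle \pi_\beta:\omega_1\le\beta<\omega_2\rangle$, where each $\pi_\beta:\beta\to\omega_1$ is a bijection, such that for any function $g:\omega_1\to\omega_1$ there exist an injective function $h:\omega_2\to\omega_2$ and a stationary (in $\omega_2$) set $I\subseteq S^2_1$ consisting of ordinals closed under $h$ such that for all $\beta\in I$ there exists a countable set $D_\beta\subseteq\beta$ such that: for all $\alpha\in\beta\setminus D_\beta$, $g(\min\{\pi_\beta(\alpha),\pi_\beta(h(\alpha))\})<\max\{\pi_\beta(\alpha),\pi_\beta(h(\alpha))\}$; and for all distinct $\alpha,\gamma\in\beta\setminus D_\beta$, $g(\min\{\pi_\beta(h(\alpha)),\pi_\beta(h(\gamma))\})<\max\{\pi_\beta(h(\alpha)),\pi_\beta(h(\gamma))\}$. $( ** )$ is the statement: for any family $\mathcal F$ of injective functions from $\omega_2$ to $\omega_2$ with $|\mathcal F|\le\omega_2$, there exists an injective function $h:\omega_2\to\omega_2$ such that for any $f\in\mathcal F$ there exists a countable set $D\subseteq\omega_2$ such that: for all $\alpha\in\omega_2\setminus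 D$, $f(\alpha)\ne h(\alpha)$; and for all distinct $\alpha,\beta\in\omega_2\setminus D$, $f(h(\alpha))\ne h(\beta)$. *)

theory Defs
  imports "HOL-Library.Countable_Set"
begin

unbundle cardinal_syntax

abbreviation aleph1 :: "nat set rel" where
  "aleph1 \<equiv> cardSuc natLeq"

abbreviation aleph2 :: "nat set set rel" where
  "aleph2 \<equiv> cardSuc aleph1"

lemma aleph1_Card_order: "Card_order aleph1"
  by (simp add: cardSuc_Card_order natLeq_Card_order)

lemma aleph2_Card_order: "Card_order aleph2"
  by (simp add: cardSuc_Card_order aleph1_Card_order)

lemma aleph1_infinite: "\<not> finite (Field aleph1)"
  using cardSuc_finite[OF natLeq_Card_order] Field_natLeq by simp

lemma aleph2_infinite: "\<not> finite (Field aleph2)"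
  using aleph1_infinite by (simp add: cardSuc_finite aleph1_Card_order)

text \<open>
  The elements of the types \<open>omega1\<close> and \<open>omega2\<close> are the ordinals below
  $\omega_1$ and below $\omega_2$: each type is a copy of the library's cardinal order
  \<open>cardSuc natLeq\<close>, \<open>cardSuc (cardSuc natLeq)\<close>, with its well-ordering. The ordinal
  \<open>\<beta>\<close>, regarded as a set, is \<open>{..<\<beta>}\<close>, and $\omega_1$, $\omega_2$ themselves are
  \<open>UNIV\<close>.
\<close>

typedef omega1 = "Field aleph1"
  using aleph1_infinite by (metis ex_in_conv finite.emptyI)

typedef omega2 = "Field aleph2"
  using aleph2_infinite by (metis ex_in_conv finite.emptyI)

lemma Well_order_wellorder_transfer:
  fixes R :: "'b \<Rightarrow> 'a"
  assumes r: "Well_order r"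
    and inj: "\<And>x y. R x = R y \<longleftrightarrow> x = y" and fld: "\<And>x. R x \<in> Field r"
  shows "(R x, R x) \<in> r"
    and "(R x, R y) \<in> r \<Longrightarrow> (R y, R z) \<in> r \<Longrightarrow> (R x, R z) \<in> r"
    and "(R x, R y) \<in> r \<Longrightarrow> (R y, R x) \<in> r \<Longrightarrow> x = y"
    and "(R x, R y) \<in> r \<or> (R y, R x) \<in> r"
    and "(\<And>x. (\<And>y. (R y, R x) \<in> r \<and> \<not> (R x, R y) \<in> r \<Longrightarrow> P y) \<Longrightarrow> P x) \<Longrightarrow> P a"
proof -
  note defs = well_order_on_def linear_order_on_def partial_order_on_def preorder_on_def
    refl_on_def trans_def antisym_def total_on_def
  show refl: "(R x, R x) \<in> r" for x using r fld unfolding defs by blast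
  show "(R x, R y) \<in> r \<Longrightarrow> (R y, R z) \<in> r \<Longrightarrow> (R x, R z) \<in> r"
    using r unfolding defs by blast
  show anti: "(R x, R y) \<in> r \<Longrightarrow> (R y, R x) \<in> r \<Longrightarrow> x = y" for x y
    using r inj[of x y] unfolding defs by blast
  show "(R x, R y) \<in> r \<or> (R y, R x) \<in> r"
    using r fld refl unfolding defs by metis
  have "wf (inv_image (r - Id) R)"
    using r unfolding well_order_on_def by (intro wf_inv_image) auto
  then show "(\<And>x. (\<And>y. (R y, R x) \<in> r \<and> \<not> (R x, R y) \<in> r \<Longrightarrow> P y) \<Longrightarrow> P x) \<Longrightarrow> P a"
  proof (induction a rule: wf_induct_rule)
    case (less x)
    show ?case
    proof (rule less.prems)
      fix y assume y: "(R y, R x) \<in> r \<and> \<not> (R x, R y) \<in> r"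
      then have "(y, x) \<in> inv_image (r - Id) R" by auto
      then show "P y" using less by blast
    qed
  qed
qed

instantiation omega1 :: wellorder
begin

definition less_eq_omega1 :: "omega1 \<Rightarrow> omega1 \<Rightarrow> bool" where
  "x \<le> y \<longleftrightarrow> (Rep_omega1 x, Rep_omega1 y) \<in> aleph1"

definition less_omega1 :: "omega1 \<Rightarrow> omega1 \<Rightarrow> bool" where
  "x < y \<longleftrightarrow> x \<le> y \<and> \<not> y \<le> (x :: omega1)"

instance
proof
  note T = Well_order_wellorder_transfer[where r = aleph1 and R = Rep_omega1,
      OF card_order_on_well_order_on[OF aleph1_Card_order] Rep_omega1_inject Rep_omega1]
  fix x y z :: omega1
  show "x < y \<longleftrightarrow> x \<le> y \<and> \<not> y \<le> x" by (rule less_omega1_def)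
  show "x \<le> x" unfolding less_eq_omega1_def by (rule T(1))
  show "x \<le> y \<Longrightarrow> y \<le> z \<Longrightarrow> x \<le> z" unfolding less_eq_omega1_def by (rule T(2))
  show "x \<le> y \<Longrightarrow> y \<le> x \<Longrightarrow> x = y" unfolding less_eq_omega1_def by (rule T(3))
  show "x \<le> y \<or> y \<le> x" unfolding less_eq_omega1_def by (rule T(4))
  show "P a" if "\<And>x. (\<And>y. y < x \<Longrightarrow> P y) \<Longrightarrow> P x" for P and a :: omega1
    using that unfolding less_omega1_def less_eq_omega1_def by (rule T(5))
qed

end

instantiation omega2 :: wellorder
begin

definition less_eq_omega2 :: "omega2 \<Rightarrow> omega2 \<Rightarrow> bool" where
  "x \<le> y \<longleftrightarrow> (Rep_omega2 x, Rep_omega2 y) \<in> aleph2"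

definition less_omega2 :: "omega2 \<Rightarrow> omega2 \<Rightarrow> bool" where
  "x < y \<longleftrightarrow> x \<le> y \<and> \<not> y \<le> (x :: omega2)"

instance
proof
  note T = Well_order_wellorder_transfer[where r = aleph2 and R = Rep_omega2,
      OF card_order_on_well_order_on[OF aleph2_Card_order] Rep_omega2_inject Rep_omega2]
  fix x y z :: omega2
  show "x < y \<longleftrightarrow> x \<le> y \<and> \<not> y \<le> x" by (rule less_omega2_def)
  show "x \<le> x" unfolding less_eq_omega2_def by (rule T(1))
  show "x \<le> y \<Longrightarrow> y \<le> z \<Longrightarrow> x \<le> z" unfolding less_eq_omega2_def by (rule T(2))
  show "x \<le> y \<Longrightarrow> y \<le> x \<Longrightarrow> x = y" unfolding less_eq_omega2_def by (rule T(3))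
  show "x \<le> y \<or> y \<le> x" unfolding less_eq_omega2_def by (rule T(4))
  show "P a" if "\<And>x. (\<And>y. y < x \<Longrightarrow> P y) \<Longrightarrow> P x" for P and a :: omega2
    using that unfolding less_omega2_def less_eq_omega2_def by (rule T(5))
qed

end

lemma omega1_order_type: "{(x, y). x \<le> (y :: omega1)} =o aleph1"
proof -
  have "inj_on Abs_omega1 (Field aleph1)"
    by (simp add: inj_on_def Abs_omega1_inject)
  then have iso: "aleph1 =o dir_image aleph1 Abs_omega1"
    by (intro dir_image_ordIso card_order_on_well_order_on aleph1_Card_order)
  have "{(x, y). x \<le> (y :: omega1)} = dir_image aleph1 Abs_omega1"
  proof (intro set_eqI iffI)
    fix p :: "omega1 \<times> omega1"
    assume "p \<in> {(x, y). x \<le> y}"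
    then show "p \<in> dir_image aleph1 Abs_omega1"
      unfolding dir_image_def less_eq_omega1_def
      by (cases p, clarsimp) (metis Rep_omega1_inverse)
  next
    fix p :: "omega1 \<times> omega1"
    assume "p \<in> dir_image aleph1 Abs_omega1"
    then show "p \<in> {(x, y). x \<le> y}"
      unfolding dir_image_def less_eq_omega1_def
      by (auto simp: Abs_omega1_inverse FieldI1 FieldI2)
  qed
  then show ?thesis using iso ordIso_symmetric by metis
qed

lemma omega2_order_type: "{(x, y). x \<le> (y :: omega2)} =o aleph2"
proof -
  have "inj_on Abs_omega2 (Field aleph2)"
    by (simp add: inj_on_def Abs_omega2_inject)
  then have iso: "aleph2 =o dir_image aleph2 Abs_omega2"
    by (intro dir_image_ordIso card_order_on_well_order_on aleph2_Card_order)
  have "{(x, y). x \<le> (y :: omega2)} = dir_image aleph2 Abs_omega2"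
  proof (intro set_eqI iffI)
    fix p :: "omega2 \<times> omega2"
    assume "p \<in> {(x, y). x \<le> y}"
    then show "p \<in> dir_image aleph2 Abs_omega2"
      unfolding dir_image_def less_eq_omega2_def
      by (cases p, clarsimp) (metis Rep_omega2_inverse)
  next
    fix p :: "omega2 \<times> omega2"
    assume "p \<in> dir_image aleph2 Abs_omega2"
    then show "p \<in> {(x, y). x \<le> y}"
      unfolding dir_image_def less_eq_omega2_def
      by (auto simp: Abs_omega2_inverse FieldI1 FieldI2)
  qed
  then show ?thesis using iso ordIso_symmetric by metis
qed

text \<open>$\omega_1$ as an element of $\omega_2$.\<close>

definition w1 :: omega2 where
  "w1 = (LEAST \<beta>. \<not> countable {..<\<beta>})"

lemma uncountable_below_w1: "\<not> countable {..<w1}"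
proof -
  have "aleph1 <o aleph2" by (simp add: aleph1_Card_order cardSuc_greater)
  then obtain a where a: "a \<in> Field aleph2" "aleph1 =o Restr aleph2 (underS aleph2 a)"
    using ordLess_iff_ordIso_Restr[OF card_order_on_well_order_on[OF aleph2_Card_order]
      card_order_on_well_order_on[OF aleph1_Card_order]] by blast
  have unc: "\<not> countable (underS aleph2 a)"
  proof
    assume "countable (underS aleph2 a)"
    then have le: "|underS aleph2 a| \<le>o natLeq"
      by (metis countable_def card_of_ordLeq card_of_nat ordLeq_ordIso_trans subset_UNIV)
    obtain f where "iso aleph1 (Restr aleph2 (underS aleph2 a)) f"
      using a(2) unfolding ordIso_def by auto
    then have "bij_betw f (Field aleph1) (Field (Restr aleph2 (underS aleph2 a)))"
      by (simp add: iso_def)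
    moreover have "Field (Restr aleph2 (underS aleph2 a)) \<subseteq> underS aleph2 a"
      by (auto simp: Field_def)
    ultimately have "|Field aleph1| \<le>o |underS aleph2 a|"
      by (metis bij_betw_imp_inj_on bij_betw_imp_surj_on card_of_ordLeq)
    then have "|Field aleph1| \<le>o natLeq" using le ordLeq_transitive by blast
    then have "aleph1 \<le>o natLeq"
      using card_of_Field_ordIso[OF aleph1_Card_order] ordIso_ordLeq_trans ordIso_symmetric
      by blast
    then show False
      using cardSuc_greater[OF natLeq_Card_order] not_ordLess_ordLeq by blast
  qed
  have "Rep_omega2 ` {..<Abs_omega2 a} = underS aleph2 a"
  proof (intro set_eqI iffI)
    fix x assume "x \<in> Rep_omega2 ` {..<Abs_omega2 a}"
    then obtain y where "x = Rep_omega2 y" "y < Abs_omega2 a" by auto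
    then show "x \<in> underS aleph2 a"
      using a(1) unfolding less_le less_eq_omega2_def underS_def
      by (auto simp: Abs_omega2_inverse Rep_omega2_inverse)
  next
    fix x assume "x \<in> underS aleph2 a"
    then have x: "(x, a) \<in> aleph2" "x \<noteq> a" "x \<in> Field aleph2"
      by (auto simp: underS_def Field_def)
    then have "Abs_omega2 x < Abs_omega2 a"
      using a(1) unfolding less_le less_eq_omega2_def
      by (auto simp: Abs_omega2_inverse Abs_omega2_inject)
    then show "x \<in> Rep_omega2 ` {..<Abs_omega2 a}"
      using x(3) by (metis Abs_omega2_inverse imageI lessThan_iff)
  qed
  then have "\<not> countable {..<Abs_omega2 a}" using unc by (metis countable_image)
  then show ?thesis unfolding w1_def by (rule LeastI)
qed

text \<open>A nonempty \<open>{..<\<delta>}\<close> in which a set is strictly unbounded has no last element, so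
  \<open>\<delta>\<close> below is a limit ordinal.\<close>

definition club :: "'a::wellorder set \<Rightarrow> bool" where
  "club C \<longleftrightarrow>
     (\<forall>\<alpha>. \<exists>\<beta>\<in>C. \<alpha> < \<beta>) \<and>
     (\<forall>\<delta>. {..<\<delta>} \<noteq> {} \<and> (\<forall>\<alpha><\<delta>. \<exists>\<beta>\<in>C. \<alpha> < \<beta> \<and> \<beta> < \<delta>) \<longrightarrow> \<delta> \<in> C)"

definition stationary :: "'a::wellorder set \<Rightarrow> bool" where
  "stationary S \<longleftrightarrow> (\<forall>C. club C \<longrightarrow> S \<inter> C \<noteq> {})"

definition cofinal_below :: "'a::wellorder set \<Rightarrow> 'a \<Rightarrow> bool" where
  "cofinal_below A \<alpha> \<longleftrightarrow> A \<subseteq> {..<\<alpha>} \<and> (\<forall>\<xi><\<alpha>. \<exists>a\<in>A. \<xi> \<le> a)"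

text \<open>\<open>has_cofinality \<alpha> r\<close>: the least cardinality of a cofinal subset of \<open>\<alpha>\<close> is that of
  the cardinal \<open>r\<close>.\<close>

definition has_cofinality :: "'a::wellorder \<Rightarrow> 'b rel \<Rightarrow> bool" where
  "has_cofinality \<alpha> r \<longleftrightarrow>
     (\<exists>A. cofinal_below A \<alpha> \<and> |A| =o r) \<and> (\<forall>A. cofinal_below A \<alpha> \<longrightarrow> r \<le>o |A| )"

definition S21 :: "omega2 set" where
  "S21 = {\<alpha>. has_cofinality \<alpha> aleph1}"

definition closed_under :: "'a::wellorder \<Rightarrow> ('a \<Rightarrow> 'a) \<Rightarrow> bool" where
  "closed_under \<beta> h \<longleftrightarrow> (\<forall>\<alpha><\<beta>. h \<alpha> < \<beta>)"

definition statement_A :: bool where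
  "statement_A \<longleftrightarrow>
     (\<forall>\<C> :: omega1 set set. |\<C>| \<le>o aleph2 \<and> (\<forall>C\<in>\<C>. club C) \<longrightarrow>
        (\<exists>E. club E \<and> (\<forall>C\<in>\<C>. countable (E - C))))"

text \<open>The values of \<open>\<pi> \<beta>\<close> outside \<open>{..<\<beta>}\<close>, and \<open>\<pi> \<beta>\<close> for \<open>\<beta> < w1\<close>, are
  unconstrained and never used: members of \<open>S21\<close> are uncountable, so at least \<open>w1\<close>, and
  every argument of \<open>\<pi> \<beta>\<close> is below \<open>\<beta>\<close> by closure under \<open>h\<close>.\<close>

definition statement_B :: bool where
  "statement_B \<longleftrightarrow>
     (\<exists>\<pi> :: omega2 \<Rightarrow> omega2 \<Rightarrow> omega1.
        (\<forall>\<beta>\<ge>w1. bij_betw (\<pi> \<beta>) {..<\<beta>} UNIV) \<and>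
        (\<forall>g :: omega1 \<Rightarrow> omega1. \<exists>h :: omega2 \<Rightarrow> omega2. \<exists>I.
           inj h \<and> stationary I \<and> I \<subseteq> S21 \<and> (\<forall>\<beta>\<in>I. closed_under \<beta> h) \<and>
           (\<forall>\<beta>\<in>I. \<exists>D. D \<subseteq> {..<\<beta>} \<and> countable D \<and>
              (\<forall>\<alpha>\<in>{..<\<beta>} - D.
                 g (min (\<pi> \<beta> \<alpha>) (\<pi> \<beta> (h \<alpha>))) < max (\<pi> \<beta> \<alpha>) (\<pi> \<beta> (h \<alpha>))) \<and>
              (\<forall>\<alpha>\<in>{..<\<beta>} - D. \<forall>\<gamma>\<in>{..<\<beta>} - D. \<alpha> \<noteq> \<gamma> \<longrightarrow>
                 g (min (\<pi> \<beta> (h \<alpha>)) (\<pi> \<beta> (h \<gamma>))) < max (\<pi> \<beta> (h \<alpha>)) (\<pi> \<beta> (h \<gamma>))))))"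

definition statement_star_star :: bool where
  "statement_star_star \<longleftrightarrow>
     (\<forall>\<F> :: (omega2 \<Rightarrow> omega2) set. |\<F>| \<le>o aleph2 \<and> (\<forall>f\<in>\<F>. inj f) \<longrightarrow>
        (\<exists>h :: omega2 \<Rightarrow> omega2. inj h \<and>
           (\<forall>f\<in>\<F>. \<exists>D. countable D \<and>
              (\<forall>\<alpha>\<in>- D. f \<alpha> \<noteq> h \<alpha>) \<and>
              (\<forall>\<alpha>\<in>- D. \<forall>\<beta>\<in>- D. \<alpha> \<noteq> \<beta> \<longrightarrow> f (h \<alpha>) \<noteq> h \<beta>))))"

end

theory Submission
  imports Defs
begin

text \<open>
  Fix bijections $\pi_\beta : \beta \to \omega_1$ and call $i, j$ \<open>g\<close>-close if
  $\max(i,j) \le g(\min(i,j))$. Pulled back along $\pi_\beta$, closeness is a symmetric relation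
  on $\beta$ in which every point has countably many neighbours, hence it is a countable union of
  partial injections. Applying $(**)$ to all of these, for all $\beta$ and for $\omega_2$ many $g$
  at once, yields an \<open>h\<close> whose values are pairwise far apart modulo a countable set.
  One such $\beta$ gives (A): $\pi_\beta \circ h$ has uncountable range, and the limit points of
  this range form a club almost contained in each given club. Conversely, (A) yields a function
  $g$ dominating, for all given $f$ and all $\beta$, the functions through which $f$ and $f^{-1}$
  act on $\omega_1$ via $\pi_\beta$. Points related by $f$ are then \<open>g\<close>-close, so the
  exceptions to $(**)$ are countable below cofinally many $\beta$, hence countable.
\<close>

section \<open>Cardinalities of \<open>omega1\<close>, \<open>omega2\<close> and of their initial
  segments\<close>

lemma card_omega1: "|UNIV :: omega1 set| =o aleph1"
proof -
  have "bij_betw Rep_omega1 UNIV (Field aleph1)"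
    by (metis bij_betw_def Rep_omega1_inject injI type_definition.Rep_range
        type_definition_omega1)
  then have "|UNIV :: omega1 set| =o |Field aleph1|"
    using card_of_ordIso by blast
  then show ?thesis
    using card_of_Field_ordIso[OF aleph1_Card_order] ordIso_transitive by blast
qed

lemma card_omega2: "|UNIV :: omega2 set| =o aleph2"
proof -
  have "bij_betw Rep_omega2 UNIV (Field aleph2)"
    by (metis bij_betw_def Rep_omega2_inject injI type_definition.Rep_range
        type_definition_omega2)
  then have "|UNIV :: omega2 set| =o |Field aleph2|"
    using card_of_ordIso by blast
  then show ?thesis
    using card_of_Field_ordIso[OF aleph2_Card_order] ordIso_transitive by blast
qed

lemma countable_iff_ordLeq_natLeq: "countable A \<longleftrightarrow> |A| \<le>o natLeq"
proof -
  have "countable A \<longleftrightarrow> |A| \<le>o |UNIV :: nat set|"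
    unfolding countable_def card_of_ordLeq[symmetric] by simp
  then show ?thesis
    by (meson card_of_nat ordIso_symmetric ordLeq_ordIso_trans)
qed

lemma countable_iff_ordLess_aleph1: "countable A \<longleftrightarrow> |A| <o aleph1"
  unfolding countable_iff_ordLeq_natLeq
  using cardSuc_ordLeq_ordLess[OF natLeq_Card_order card_of_Card_order] by blast

lemma uncountable_iff_aleph1_ordLeq: "uncountable A \<longleftrightarrow> aleph1 \<le>o |A|"
  unfolding countable_iff_ordLess_aleph1
  by (intro not_ordLess_iff_ordLeq card_of_Well_order card_order_on_well_order_on
      aleph1_Card_order)

lemma countable_ordLeq_aleph1: "countable A \<Longrightarrow> |A| \<le>o aleph1"
  unfolding countable_iff_ordLess_aleph1 by (rule ordLess_imp_ordLeq)

lemma countable_ordLeq_aleph2: "countable A \<Longrightarrow> |A| \<le>o aleph2"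
  by (rule ordLeq_transitive[OF countable_ordLeq_aleph1 cardSuc_ordLeq[OF aleph1_Card_order]])

lemma uncountable_omega1: "uncountable (UNIV :: omega1 set)"
  unfolding uncountable_iff_aleph1_ordLeq
  by (rule ordIso_imp_ordLeq[OF ordIso_symmetric[OF card_omega1]])

lemma countable_lessThan_omega1 [simp]: "countable {..<i :: omega1}"
proof -
  have "|underS aleph1 (Rep_omega1 i)| <o aleph1"
    by (rule card_of_underS[OF aleph1_Card_order Rep_omega1])
  moreover have "Rep_omega1 ` {..<i} \<subseteq> underS aleph1 (Rep_omega1 i)"
    unfolding underS_def
    by (auto simp: Rep_omega1_inject less_imp_le simp flip: less_eq_omega1_def)
  ultimately have "countable (Rep_omega1 ` {..<i})"
    unfolding countable_iff_ordLess_aleph1[symmetric] using countable_subset by blast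
  then show ?thesis
    by (rule countable_image_inj_on) (simp add: inj_on_def Rep_omega1_inject)
qed

lemma card_lessThan_omega2: "|{..<\<beta> :: omega2}| \<le>o aleph1"
proof -
  have "|underS aleph2 (Rep_omega2 \<beta>)| <o aleph2"
    by (rule card_of_underS[OF aleph2_Card_order Rep_omega2])
  moreover have "Rep_omega2 ` {..<\<beta>} \<subseteq> underS aleph2 (Rep_omega2 \<beta>)"
    unfolding underS_def
    by (auto simp: Rep_omega2_inject less_imp_le simp flip: less_eq_omega2_def)
  then have "|{..<\<beta>}| \<le>o |underS aleph2 (Rep_omega2 \<beta>)|"
    by (intro card_of_ordLeq[THEN iffD1] exI[of _ Rep_omega2])
      (simp add: inj_on_def Rep_omega2_inject)
  ultimately have "|{..<\<beta>}| <o aleph2"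
    using ordLeq_ordLess_trans by blast
  then show ?thesis
    by (rule cardSuc_ordLeq_ordLess[OF aleph1_Card_order card_of_Card_order, THEN iffD1])
qed

lemma countable_atMost_omega1 [simp]: "countable {..i :: omega1}"
  by (simp flip: ivl_disj_un_singleton(2))

lemma card_atMost_omega2: "|{..\<beta> :: omega2}| \<le>o aleph1"
  unfolding ivl_disj_un_singleton(2)[symmetric]
  by (intro card_of_Un_ordLeq_infinite_Field aleph1_infinite card_lessThan_omega2
      aleph1_Card_order countable_ordLeq_aleph1) auto

section \<open>Regularity: small sets are bounded\<close>

lemma countable_bounded_omega1:
  assumes "countable (A :: omega1 set)"
  shows "\<exists>b. \<forall>a\<in>A. a < b"
proof (rule ccontr)
  assume "\<not> ?thesis"
  then have "(\<Union>a\<in>A. {..a}) = UNIV" by (auto simp: not_less)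
  moreover have "countable (\<Union>a\<in>A. {..a})" using assms by (intro countable_UN) auto
  ultimately show False using uncountable_omega1 by simp
qed

lemma uncountable_unbounded_omega1:
  assumes "uncountable (X :: omega1 set)"
  shows "\<exists>x\<in>X. i < x"
proof (rule ccontr)
  assume "\<not> ?thesis"
  then have "X \<subseteq> {..i}" by (auto simp: not_less)
  then show False using assms countable_subset[OF _ countable_atMost_omega1] by simp
qed

text \<open>This is the regularity of \<open>omega2\<close>: otherwise \<open>omega2\<close> would
  be a union of at most \<open>aleph1\<close> many initial segments, each of size at most
  \<open>aleph1\<close>.\<close>

lemma bounded_omega2:
  assumes "|A :: omega2 set| \<le>o aleph1"
  shows "\<exists>b. \<forall>a\<in>A. a < b"
proof (rule ccontr)
  assume "\<not> ?thesis"
  then have "(\<Union>a\<in>A. {..a}) = UNIV" by (auto simp: not_less)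
  moreover have "|\<Union>a\<in>A. {..a}| \<le>o aleph1"
    by (intro card_of_UNION_ordLeq_infinite_Field aleph1_infinite aleph1_Card_order assms ballI
        card_atMost_omega2)
  ultimately have "aleph2 \<le>o aleph1"
    using ordIso_ordLeq_trans[OF ordIso_symmetric[OF card_omega2]] by simp
  then show False
    using cardSuc_greater[OF aleph1_Card_order] not_ordLess_ordLeq by blast
qed

text \<open>An uncountable X contains the range of an injection from \<open>omega1\<close>. That
  range is bounded, so it lies in a single countable piece of X.\<close>

lemma countable_omega2_if_locally_countable:
  fixes X :: "omega2 set"
  assumes "\<And>b. \<exists>\<beta>>b. countable (X \<inter> {..<\<beta>})"
  shows "countable X"
proof (rule ccontr)
  assume "uncountable X"
  then have "|UNIV :: omega1 set| \<le>o |X|"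
    by (intro ordIso_ordLeq_trans[OF card_omega1] uncountable_iff_aleph1_ordLeq[THEN iffD1])
  then obtain s :: "omega1 \<Rightarrow> omega2" where s: "inj s" "range s \<subseteq> X"
    unfolding card_of_ordLeq[symmetric] by auto
  have "|range s| \<le>o aleph1"
    by (rule ordLeq_ordIso_trans[OF card_of_image card_omega1])
  from bounded_omega2[OF this] obtain b where b: "\<forall>i. s i < b" by blast
  obtain \<beta> where \<beta>: "b < \<beta>" "countable (X \<inter> {..<\<beta>})" using assms by blast
  have "range s \<subseteq> X \<inter> {..<\<beta>}" using s b \<beta>(1) by (auto intro: less_trans)
  then have "countable (range s)" using countable_subset[OF _ \<beta>(2)] by simp
  then show False
    using s(1) uncountable_omega1 by (simp add: countable_image_inj_eq)
qed

section \<open>Clubs in \<open>omega1\<close>\<close>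

text \<open>Iterate from \<alpha> a function \<open>N\<close> such that \<open>N x\<close> exceeds x
  and all values of f up to x. The supremum of the countably many iterates is closed under
  f.\<close>

lemma closed_under_cofinal_omega1: "\<exists>\<delta>>\<alpha>. closed_under \<delta> (f :: omega1 \<Rightarrow> omega1)"
proof -
  have "\<exists>y>x. \<forall>z\<le>x. f z < y" for x
    using countable_bounded_omega1[of "insert x (f ` {..x})"] by auto
  then obtain N where N: "\<And>x. x < N x" "\<And>x z. z \<le> x \<Longrightarrow> f z < N x" by metis
  define s where "s n = (N ^^ n) \<alpha>" for n
  have s0: "s 0 = \<alpha>" and sS: "s (Suc n) = N (s n)" for n by (simp_all add: s_def)
  define \<delta> where "\<delta> = (LEAST y. \<forall>n. s n < y)"
  have "\<exists>y. \<forall>n. s n < y" using countable_bounded_omega1[of "range s"] by auto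
  from LeastI_ex[OF this] have \<delta>: "s n < \<delta>" for n unfolding \<delta>_def by blast
  have "f x < \<delta>" if x: "x < \<delta>" for x
  proof -
    obtain n where "x \<le> s n" using not_less_Least[OF x[unfolded \<delta>_def]] not_less by blast
    then show ?thesis using less_trans[OF N(2) \<delta>[of "Suc n", unfolded sS]] by blast
  qed
  then show ?thesis using \<delta>[of 0] s0 unfolding closed_under_def by auto
qed

lemma club_closed_under_omega1: "club {\<delta>. closed_under \<delta> (f :: omega1 \<Rightarrow> omega1)}"
  unfolding club_def
proof (intro conjI allI impI)
  fix \<alpha> show "\<exists>\<beta>\<in>{\<delta>. closed_under \<delta> f}. \<alpha> < \<beta>"
    using closed_under_cofinal_omega1[of \<alpha> f] by auto
next
  fix \<delta>
  assume "{..<\<delta>} \<noteq> {} \<and> (\<forall>\<alpha><\<delta>. \<exists>\<beta>\<in>{\<delta>. closed_under \<delta> f}. \<alpha> < \<beta> \<and> \<beta> < \<delta>)"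
  then show "\<delta> \<in> {\<delta>. closed_under \<delta> f}"
    unfolding closed_under_def by (auto intro: less_trans)
qed

text \<open>For unboundedness, take a map sending each i to a larger element of X: every nonzero
  ordinal closed under this map is a limit point of X, and such ordinals are cofinal.\<close>

lemma club_limit_points_omega1:
  assumes "uncountable (X :: omega1 set)"
  shows "club {\<delta>. {..<\<delta>} \<noteq> {} \<and> (\<forall>\<alpha><\<delta>. \<exists>x\<in>X. \<alpha> < x \<and> x < \<delta>)}" (is "club ?E")
  unfolding club_def
proof (intro conjI allI impI)
  fix \<alpha>
  obtain N where N: "\<And>i. N i \<in> X \<and> i < N i"
    using uncountable_unbounded_omega1[OF assms] by metis
  obtain \<delta> where "\<alpha> < \<delta>" "closed_under \<delta> N" using closed_under_cofinal_omega1 by blast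
  then show "\<exists>\<beta>\<in>?E. \<alpha> < \<beta>"
    using N unfolding closed_under_def by blast
next
  fix \<delta>
  assume "{..<\<delta>} \<noteq> {} \<and> (\<forall>\<alpha><\<delta>. \<exists>\<beta>\<in>?E. \<alpha> < \<beta> \<and> \<beta> < \<delta>)"
  then show "\<delta> \<in> ?E" by (blast intro: less_trans)
qed

section \<open>Closure points in \<open>S21\<close> and stationarity\<close>

text \<open>The closing-off runs through \<open>omega1\<close> many steps, so that its supremum
  \<delta> has cofinality \<open>aleph1\<close>: countably many points below \<delta> use countably
  many indices, which are bounded in \<open>omega1\<close>. Letting \<open>H\<close> take countable
  sets as values handles several functions and constants at once.\<close>

lemma S21_closed_point:
  fixes H :: "omega2 \<Rightarrow> omega2 set"
  assumes H: "\<And>x. countable (H x)"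
  shows "\<exists>\<delta>\<in>S21. \<forall>x<\<delta>. H x \<subseteq> {..<\<delta>}"
proof -
  have "\<exists>b>x. \<forall>z\<le>x. \<forall>y\<in>H z. y < b" for x
  proof -
    have "|{x} \<union> (\<Union>z\<in>{..x}. H z)| \<le>o aleph1"
      by (intro card_of_Un_ordLeq_infinite_Field card_of_UNION_ordLeq_infinite_Field
          aleph1_infinite aleph1_Card_order ballI card_atMost_omega2 countable_ordLeq_aleph1 H)
        auto
    from bounded_omega2[OF this] obtain b where "x < b" "\<forall>z\<le>x. \<forall>y\<in>H z. y < b" by auto
    then show ?thesis by blast
  qed
  then obtain N where N: "\<And>x. x < N x" "\<And>x z y. z \<le> x \<Longrightarrow> y \<in> H z \<Longrightarrow> y < N x" by metis
  \<comment> \<open>By well-founded recursion \<open>s i\<close> is the least strict upper bound of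
    the values \<open>N (s j)\<close> with j < i. There are only countably many of these, so a bound
    exists.\<close>
  define s :: "omega1 \<Rightarrow> omega2" where
    "s = wfrec {(x, y). x < y} (\<lambda>s i. LEAST b. \<forall>j<i. N (s j) < b)"
  have s_rec: "s i = (LEAST b. \<forall>j<i. N (s j) < b)" for i
    by (subst def_wfrec[OF s_def[THEN eq_reflection] wf]) (simp add: cut_def)
  have Ns: "N (s j) < s i" if "j < i" for i j
  proof -
    have "|(\<lambda>j. N (s j)) ` {..<i}| \<le>o aleph1"
      by (intro countable_ordLeq_aleph1) simp
    from bounded_omega2[OF this] have "\<exists>b. \<forall>j<i. N (s j) < b" by auto
    from LeastI_ex[OF this] show ?thesis using that unfolding s_rec[of i] by blast
  qed
  then have s_mono: "j < i \<Longrightarrow> s j < s i" for i j using N(1) less_trans by blast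
  have "inj s" by (rule linorder_injI) (auto dest: s_mono)
  then have card_s: "|range s| =o aleph1"
    by (intro ordIso_transitive[OF ordIso_symmetric card_omega1] card_of_ordIso[THEN iffD1]
        exI[of _ s]) (simp add: bij_betw_def)
  define \<delta> where "\<delta> = (LEAST y. \<forall>i. s i < y)"
  have "\<exists>y. \<forall>i. s i < y" using bounded_omega2[OF ordIso_imp_ordLeq[OF card_s]] by blast
  from LeastI_ex[OF this] have \<delta>: "s i < \<delta>" for i unfolding \<delta>_def by blast
  have below: "\<exists>i. x \<le> s i" if "x < \<delta>" for x
    using not_less_Least[OF that[unfolded \<delta>_def]] not_less by blast
  have larger: "\<exists>j. i < j" for i :: omega1
    using countable_bounded_omega1[of "{i}"] by simp
  have "H x \<subseteq> {..<\<delta>}" if x: "x < \<delta>" for x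
  proof
    fix y assume y: "y \<in> H x"
    obtain i where "x \<le> s i" using below[OF x] by blast
    then have "y < N (s i)" by (rule N(2)[OF _ y])
    moreover obtain j where "N (s i) < s j" using Ns larger[of i] by blast
    ultimately show "y \<in> {..<\<delta>}" using \<delta>[of j] by (auto intro: less_trans)
  qed
  moreover have "\<delta> \<in> S21"
    unfolding S21_def has_cofinality_def mem_Collect_eq
  proof (intro conjI exI[of _ "range s"] allI impI)
    show "cofinal_below (range s) \<delta>"
      using \<delta> below unfolding cofinal_below_def by auto
    show "|range s| =o aleph1" by (rule card_s)
    fix A assume A: "cofinal_below A \<delta>"
    show "aleph1 \<le>o |A|"
    proof (rule ccontr)
      assume "\<not> aleph1 \<le>o |A|"
      then have "countable A" using uncountable_iff_aleph1_ordLeq by blast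
      moreover have "\<forall>a\<in>A. \<exists>i. a \<le> s i" using A below unfolding cofinal_below_def by blast
      from bchoice[OF this] obtain k where k: "\<And>a. a \<in> A \<Longrightarrow> a \<le> s (k a)" by blast
      ultimately obtain i where "\<forall>a\<in>A. k a < i"
        using countable_bounded_omega1[of "k ` A"] by auto
      then have "\<forall>a\<in>A. a < s i" using le_less_trans[OF k s_mono] by blast
      moreover have "\<exists>a\<in>A. s i \<le> a" using A \<delta>[of i] unfolding cofinal_below_def by blast
      ultimately show False using leD by blast
    qed
  qed
  ultimately show ?thesis by blast
qed

lemma S21_uncountable:
  assumes "\<beta> \<in> S21"
  shows "uncountable {..<\<beta>}"
proof -
  have "cofinal_below {..<\<beta>} \<beta>" by (auto simp: cofinal_below_def)
  then show ?thesis
    using assms unfolding S21_def has_cofinality_def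
    by (simp add: uncountable_iff_aleph1_ordLeq)
qed

lemma uncountable_imp_w1_le: "uncountable {..<\<beta>} \<Longrightarrow> w1 \<le> \<beta>"
  unfolding w1_def by (rule Least_le)

lemma S21_w1_le: "\<beta> \<in> S21 \<Longrightarrow> w1 \<le> \<beta>"
  by (simp add: S21_uncountable uncountable_imp_w1_le)

lemma S21_nonempty: "\<beta> \<in> S21 \<Longrightarrow> {..<\<beta>} \<noteq> {}"
  using S21_uncountable by fastforce

lemma club_closed_under_setvalued_omega2:
  fixes H :: "omega2 \<Rightarrow> omega2 set"
  assumes "\<And>x. countable (H x)"
  shows "club {\<delta>. \<forall>x<\<delta>. H x \<subseteq> {..<\<delta>}}"
  unfolding club_def
proof (intro conjI allI impI)
  fix \<alpha>
  \<comment> \<open>Inserting \<alpha> into every value forces \<alpha> < \<delta>, because \<delta>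
    is nonzero.\<close>
  obtain \<delta> where \<delta>: "\<delta> \<in> S21" "\<forall>x<\<delta>. insert \<alpha> (H x) \<subseteq> {..<\<delta>}"
    using S21_closed_point[of "\<lambda>x. insert \<alpha> (H x)", OF countable_insert[OF assms]] by blast
  then have "\<alpha> < \<delta>" using S21_nonempty by blast
  then show "\<exists>\<beta>\<in>{\<delta>. \<forall>x<\<delta>. H x \<subseteq> {..<\<delta>}}. \<alpha> < \<beta>" using \<delta>(2) by blast
next
  fix \<delta>
  assume "{..<\<delta>} \<noteq> {} \<and> (\<forall>\<alpha><\<delta>. \<exists>\<beta>\<in>{\<delta>. \<forall>x<\<delta>. H x \<subseteq> {..<\<delta>}}. \<alpha> < \<beta> \<and> \<beta> < \<delta>)"
  then have lim: "\<exists>\<beta>. (\<forall>x<\<beta>. H x \<subseteq> {..<\<beta>}) \<and> \<alpha> < \<beta> \<and> \<beta> < \<delta>" if "\<alpha> < \<delta>" for \<alpha>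
    using that by blast
  have "H x \<subseteq> {..<\<delta>}" if x: "x < \<delta>" for x
  proof -
    obtain \<beta> where "H x \<subseteq> {..<\<beta>}" "\<beta> < \<delta>" using lim[OF x] by blast
    then show ?thesis by (auto intro: less_trans)
  qed
  then show "\<delta> \<in> {\<delta>. \<forall>x<\<delta>. H x \<subseteq> {..<\<delta>}}" by blast
qed

text \<open>Given a club C, close under h together with a map \<open>N\<close> picking larger
  elements of C. The closure point is then a limit of elements of C, hence itself in C.\<close>

lemma stationary_closed_S21:
  fixes h :: "omega2 \<Rightarrow> omega2"
  shows "stationary {\<beta>\<in>S21. closed_under \<beta> h}"
  unfolding stationary_def
proof (intro allI impI)
  fix C :: "omega2 set" assume C: "club C"
  then obtain N where N: "\<And>x. N x \<in> C \<and> x < N x" unfolding club_def by metis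
  obtain \<delta> where \<delta>: "\<delta> \<in> S21" "\<forall>x<\<delta>. {h x, N x} \<subseteq> {..<\<delta>}"
    using S21_closed_point[of "\<lambda>x. {h x, N x}"] by auto
  then have "\<forall>\<alpha><\<delta>. \<exists>\<beta>\<in>C. \<alpha> < \<beta> \<and> \<beta> < \<delta>" using N by blast
  then have "\<delta> \<in> C" using C S21_nonempty[OF \<delta>(1)] unfolding club_def by blast
  then show "{\<beta>\<in>S21. closed_under \<beta> h} \<inter> C \<noteq> {}"
    using \<delta> unfolding closed_under_def by blast
qed

section \<open>Bijections onto \<open>omega1\<close> and coverings by injections\<close>

lemma bij_lessThan_omega2_omega1:
  assumes "w1 \<le> \<beta>"
  shows "\<exists>p. bij_betw p {..<\<beta>} (UNIV :: omega1 set)"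
proof -
  have "uncountable {..<\<beta>}"
    using uncountable_below_w1 assms by (meson countable_subset lessThan_subset_iff)
  then have "|{..<\<beta>}| =o aleph1"
    unfolding ordIso_iff_ordLeq uncountable_iff_aleph1_ordLeq
    using card_lessThan_omega2 by blast
  then have "|{..<\<beta>}| =o |UNIV :: omega1 set|"
    by (rule ordIso_transitive[OF _ ordIso_symmetric[OF card_omega1]])
  then show ?thesis unfolding card_of_ordIso[symmetric] .
qed

text \<open>A final segment has size \<open>aleph2\<close>, since a smaller one would be bounded. It
  supplies fresh values for extending partial injections.\<close>

lemma inj_into_tail_omega2: "\<exists>k :: omega2 \<Rightarrow> omega2. inj k \<and> (\<forall>x. \<beta> \<le> k x)"
proof -
  have "aleph2 \<le>o |{\<beta>..}|"
  proof (rule ccontr)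
    assume "\<not> ?thesis"
    then have "|{\<beta>..}| <o aleph2"
      using not_ordLeq_iff_ordLess[OF card_of_Well_order
          card_order_on_well_order_on[OF aleph2_Card_order]] by blast
    then have "|{\<beta>..}| \<le>o aleph1"
      by (rule cardSuc_ordLeq_ordLess[OF aleph1_Card_order card_of_Card_order, THEN iffD1])
    from bounded_omega2[OF this] obtain b where b: "\<forall>a\<in>{\<beta>..}. a < b" by blast
    then have "\<beta> < b" by simp
    then show False using b by (meson atLeast_iff less_imp_le less_irrefl)
  qed
  then have "|UNIV :: omega2 set| \<le>o |{\<beta>..}|"
    by (rule ordIso_ordLeq_trans[OF card_omega2])
  then obtain k :: "omega2 \<Rightarrow> omega2" where "inj k" "range k \<subseteq> {\<beta>..}"
    unfolding card_of_ordLeq[symmetric] by auto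
  then show ?thesis by blast
qed

text \<open>Statement \<open>( ** )\<close> speaks of total injections only. Outside A the arguments
  go into the tail from \<beta> on, which cannot meet the image of A.\<close>

lemma extend_partial_injection_omega2:
  fixes p :: "omega2 \<Rightarrow> omega2"
  assumes "inj_on p A" "p ` A \<subseteq> {..<\<beta>}"
  shows "\<exists>f. inj f \<and> (\<forall>x\<in>A. f x = p x)"
proof -
  obtain k :: "omega2 \<Rightarrow> omega2" where k: "inj k" "\<And>x. \<beta> \<le> k x" using inj_into_tail_omega2 by blast
  have "p x \<noteq> k y" if "x \<in> A" for x y
    using assms(2) that k(2)[of y] by (metis image_subset_iff leD lessThan_iff)
  then have "inj (\<lambda>x. if x \<in> A then p x else k x)"
    using assms(1) k(1) unfolding inj_def inj_on_def by metis
  then show ?thesis by (intro exI[of _ "\<lambda>x. if x \<in> A then p x else k x"]) simp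
qed

text \<open>Each edge \<open>{x, y}\<close> is coloured by the index of \<open>y\<close> among the neighbours of \<open>x\<close>
  and of \<open>x\<close> among those of \<open>y\<close>; each colour class is then a partial injection.\<close>

lemma relation_covered_by_injections_omega2:
  fixes R :: "omega2 \<Rightarrow> omega2 \<Rightarrow> bool"
  assumes R: "\<And>x y. R x y \<Longrightarrow> x < \<beta> \<and> y < \<beta>" "\<And>x y. R x y \<Longrightarrow> R y x"
    and ctbl: "\<And>x. countable {y. R x y}"
  shows "\<exists>\<Phi>. countable \<Phi> \<and> (\<forall>f\<in>\<Phi>. inj f) \<and> (\<forall>x y. R x y \<longrightarrow> (\<exists>f\<in>\<Phi>. f x = y))"
proof -
  define c where "c x = to_nat_on {y. R x y}" for x
  have c_inj: "y = z" if "R x y" "R x z" "c x y = c x z" for x y z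
    using that ctbl unfolding c_def by (metis mem_Collect_eq to_nat_on_inj)
  have "\<exists>f. inj f \<and> (\<forall>x y. R x y \<and> c x y = n \<and> c y x = m \<longrightarrow> f x = y)" for n m
  proof -
    define Q where "Q x y \<longleftrightarrow> R x y \<and> c x y = n \<and> c y x = m" for x y
    \<comment> \<open>With the colour fixed, \<open>c x y\<close> determines y from x, and
      \<open>c y x\<close> determines x from y; the second index makes sense because R is
      symmetric.\<close>
    have Q: "Q x y \<Longrightarrow> Q x z \<Longrightarrow> y = z" "Q x z \<Longrightarrow> Q y z \<Longrightarrow> x = y" for x y z
      unfolding Q_def using c_inj R(2) by blast+
    define p where "p x = (THE y. Q x y)" for x
    have p: "p x = y" if "Q x y" for x y
      unfolding p_def by (rule the_equality[where P = "Q x", OF that Q(1)[OF _ that]])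
    have "inj_on p {x. \<exists>y. Q x y}" using p Q(2) by (auto simp: inj_on_def)
    moreover have "p ` {x. \<exists>y. Q x y} \<subseteq> {..<\<beta>}" using p R(1) unfolding Q_def by auto
    ultimately have "\<exists>f. inj f \<and> (\<forall>x\<in>{x. \<exists>y. Q x y}. f x = p x)"
      by (rule extend_partial_injection_omega2)
    then obtain f where "inj f" "\<forall>x\<in>{x. \<exists>y. Q x y}. f x = p x"
      by (elim exE conjE)
    moreover from this have "f x = y" if "Q x y" for x y
      using p[OF that] that by auto
    ultimately show ?thesis unfolding Q_def by (intro exI[of _ f]) simp
  qed
  then have "\<forall>n. \<exists>F. \<forall>m. inj (F m) \<and> (\<forall>x y. R x y \<and> c x y = n \<and> c y x = m \<longrightarrow> F m x = y)"
    by (intro allI choice)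
  from choice[OF this] obtain F where F: "\<And>n m. inj (F n m)"
      "\<And>x y. R x y \<Longrightarrow> F (c x y) (c y x) x = y" by blast
  show ?thesis
  proof (intro exI[of _ "\<Union>n m. {F n m}"] conjI allI impI)
    show "countable (\<Union>n m. {F n m})" by simp
    show "\<forall>f\<in>\<Union>n m. {F n m}. inj f" using F(1) by blast
    fix x y assume "R x y"
    then show "\<exists>f\<in>\<Union>n m. {F n m}. f x = y" using F(2) by blast
  qed
qed

lemma countable_vimage_initial_segment:
  fixes p :: "omega2 \<Rightarrow> omega1"
  assumes "bij_betw p {..<\<beta>} UNIV"
  shows "countable {x. x < \<beta> \<and> p x < c}"
proof (rule countable_image_inj_on)
  show "countable (p ` {x. x < \<beta> \<and> p x < c})"
    by (rule countable_subset[of _ "{..<c}"]) auto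
  show "inj_on p {x. x < \<beta> \<and> p x < c}"
    using assms by (auto simp: bij_betw_def inj_on_def)
qed

section \<open>From \<open>( ** )\<close> to (A) and (B)\<close>

text \<open>This is the clause of \<open>statement_B\<close> for a single \<beta>, copied literally
  so that \<open>statement_B\<close> can be folded to it.\<close>

definition almost_spread ::
    "(omega2 \<Rightarrow> omega1) \<Rightarrow> omega2 \<Rightarrow> (omega1 \<Rightarrow> omega1) \<Rightarrow> (omega2 \<Rightarrow> omega2) \<Rightarrow> bool" where
  "almost_spread p \<beta> g h \<longleftrightarrow> (\<exists>D. D \<subseteq> {..<\<beta>} \<and> countable D \<and>
     (\<forall>\<alpha>\<in>{..<\<beta>} - D. g (min (p \<alpha>) (p (h \<alpha>))) < max (p \<alpha>) (p (h \<alpha>))) \<and>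
     (\<forall>\<alpha>\<in>{..<\<beta>} - D. \<forall>\<gamma>\<in>{..<\<beta>} - D. \<alpha> \<noteq> \<gamma> \<longrightarrow>
        g (min (p (h \<alpha>)) (p (h \<gamma>))) < max (p (h \<alpha>)) (p (h \<gamma>))))"

text \<open>The relation \<open>R g \<beta>\<close> is g-closeness below \<beta>, so failing it
  means being far apart. One h serves all of G: (A) needs this for a whole family of clubs, whereas
  (B) takes a singleton G.\<close>

lemma star_star_spread:
  assumes star: statement_star_star
    and bij: "\<And>\<beta>. w1 \<le> \<beta> \<Longrightarrow> bij_betw (\<pi> \<beta>) {..<\<beta>} (UNIV :: omega1 set)"
    and G: "|G :: (omega1 \<Rightarrow> omega1) set| \<le>o aleph2"
  shows "\<exists>h. inj h \<and>
    (\<forall>g\<in>G. \<forall>\<beta>\<ge>w1. closed_under \<beta> h \<longrightarrow> almost_spread (\<pi> \<beta>) \<beta> g h)"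
proof -
  define R where "R g \<beta> x y \<longleftrightarrow> x < \<beta> \<and> y < \<beta> \<and>
    max (\<pi> \<beta> x) (\<pi> \<beta> y) \<le> g (min (\<pi> \<beta> x) (\<pi> \<beta> y))" for g \<beta> x y
  define P where "P g \<beta> \<Phi> \<longleftrightarrow>
    countable \<Phi> \<and> (\<forall>f\<in>\<Phi>. inj f) \<and> (\<forall>x y. R g \<beta> x y \<longrightarrow> (\<exists>f\<in>\<Phi>. f x = y))" for g \<beta> \<Phi>
  have "\<exists>\<Phi>. P g \<beta> \<Phi>" if "w1 \<le> \<beta>" for g \<beta>
    unfolding P_def
  proof (rule relation_covered_by_injections_omega2)
    fix x y
    show "R g \<beta> x y \<Longrightarrow> x < \<beta> \<and> y < \<beta>" unfolding R_def by blast
    show "R g \<beta> x y \<Longrightarrow> R g \<beta> y x" unfolding R_def by (simp add: min.commute max.commute)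
  next
    fix x
    \<comment> \<open>If y is a neighbour of x, then \<open>\<pi> \<beta> y\<close> is at most
      \<open>\<pi> \<beta> x\<close> or at most \<open>g (\<pi> \<beta> x)\<close>.\<close>
    obtain b where b: "\<forall>a\<in>{\<pi> \<beta> x, g (\<pi> \<beta> x)}. a < b"
      using countable_bounded_omega1[of "{\<pi> \<beta> x, g (\<pi> \<beta> x)}"] by auto
    have "\<pi> \<beta> y < b" if "R g \<beta> x y" for y
      using that b unfolding R_def by (cases "\<pi> \<beta> x \<le> \<pi> \<beta> y") (auto simp: min_def max_def)
    then have "{y. R g \<beta> x y} \<subseteq> {y. y < \<beta> \<and> \<pi> \<beta> y < b}" unfolding R_def by blast
    then show "countable {y. R g \<beta> x y}"
      by (rule countable_subset) (rule countable_vimage_initial_segment[OF bij[OF that]])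
  qed
  note ex = this
  define \<Phi> where "\<Phi> g \<beta> = (SOME S. P g \<beta> S)" for g \<beta>
  have "P g \<beta> (\<Phi> g \<beta>)" if "w1 \<le> \<beta>" for g \<beta>
    unfolding \<Phi>_def by (rule someI_ex) (rule ex[OF that])
  then have \<Phi>: "\<And>g \<beta>. w1 \<le> \<beta> \<Longrightarrow> countable (\<Phi> g \<beta>)"
      "\<And>g \<beta> f. w1 \<le> \<beta> \<Longrightarrow> f \<in> \<Phi> g \<beta> \<Longrightarrow> inj f"
      "\<And>g \<beta> x y. w1 \<le> \<beta> \<Longrightarrow> R g \<beta> x y \<Longrightarrow> \<exists>f\<in>\<Phi> g \<beta>. f x = y"
    unfolding P_def by blast+
  \<comment> \<open>At most \<open>aleph2\<close> many g, at most \<open>aleph2\<close> many \<beta>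
    and countably many injections for each pair: the family is small enough for
    \<open>( ** )\<close>.\<close>
  define \<F> where "\<F> = (\<Union>g\<in>G. \<Union>\<beta>\<in>{w1..}. \<Phi> g \<beta>)"
  have "|{w1..}| \<le>o aleph2"
    by (rule ordLeq_ordIso_trans[OF card_of_mono1[OF subset_UNIV] card_omega2])
  moreover have "|\<Phi> g \<beta>| \<le>o aleph2" if "\<beta> \<in> {w1..}" for g \<beta>
    by (rule countable_ordLeq_aleph2[OF \<Phi>(1)]) (use that in simp)
  ultimately have "|\<F>| \<le>o aleph2"
    unfolding \<F>_def
    by (intro card_of_UNION_ordLeq_infinite_Field aleph2_infinite aleph2_Card_order G ballI)
  moreover have "\<forall>f\<in>\<F>. inj f" unfolding \<F>_def using \<Phi>(2) by auto
  ultimately obtain h where h: "inj h" "\<forall>f\<in>\<F>. \<exists>D. countable D \<and>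
      (\<forall>\<alpha>\<in>- D. f \<alpha> \<noteq> h \<alpha>) \<and> (\<forall>\<alpha>\<in>- D. \<forall>\<beta>\<in>- D. \<alpha> \<noteq> \<beta> \<longrightarrow> f (h \<alpha>) \<noteq> h \<beta>)"
    using star[unfolded statement_star_star_def, rule_format, of \<F>] by blast
  from bchoice[OF h(2)] obtain D where "\<forall>f\<in>\<F>. countable (D f) \<and> (\<forall>\<alpha>\<in>- D f. f \<alpha> \<noteq> h \<alpha>) \<and>
      (\<forall>\<alpha>\<in>- D f. \<forall>\<beta>\<in>- D f. \<alpha> \<noteq> \<beta> \<longrightarrow> f (h \<alpha>) \<noteq> h \<beta>)" ..
  then have D: "\<And>f. f \<in> \<F> \<Longrightarrow> countable (D f)"
      "\<And>f \<alpha>. f \<in> \<F> \<Longrightarrow> \<alpha> \<notin> D f \<Longrightarrow> f \<alpha> \<noteq> h \<alpha>"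
      "\<And>f \<alpha> \<beta>. f \<in> \<F> \<Longrightarrow> \<alpha> \<notin> D f \<Longrightarrow> \<beta> \<notin> D f \<Longrightarrow> \<alpha> \<noteq> \<beta> \<Longrightarrow> f (h \<alpha>) \<noteq> h \<beta>"
    by simp_all
  show ?thesis
  proof (intro exI[of _ h] conjI ballI allI impI h(1))
    fix g \<beta> assume g: "g \<in> G" and \<beta>: "w1 \<le> \<beta>" and cl: "closed_under \<beta> h"
    have sub: "\<Phi> g \<beta> \<subseteq> \<F>" using g \<beta> unfolding \<F>_def by auto
    \<comment> \<open>A union of countably many countable exceptional sets. A close pair produced by
      points outside \<open>E\<close> would be realised by some f in
      \<open>\<Phi> g \<beta>\<close>, which h avoids there.\<close>
    define E where "E = (\<Union>f\<in>\<Phi> g \<beta>. D f)"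
    have "countable E" unfolding E_def using \<Phi>(1)[OF \<beta>] D(1) sub by blast
    moreover have "\<not> R g \<beta> \<alpha> (h \<alpha>)" if "\<alpha> \<notin> E" for \<alpha>
      using \<Phi>(3)[OF \<beta>] D(2) sub that unfolding E_def by blast
    then have "g (min (\<pi> \<beta> \<alpha>) (\<pi> \<beta> (h \<alpha>))) < max (\<pi> \<beta> \<alpha>) (\<pi> \<beta> (h \<alpha>))"
      if "\<alpha> \<notin> E" "\<alpha> < \<beta>" for \<alpha>
      using cl that unfolding R_def closed_under_def not_le[symmetric] by blast
    moreover have "\<not> R g \<beta> (h \<alpha>) (h \<gamma>)" if "\<alpha> \<notin> E" "\<gamma> \<notin> E" "\<alpha> \<noteq> \<gamma>" for \<alpha> \<gamma>
      using \<Phi>(3)[OF \<beta>, of g "h \<alpha>" "h \<gamma>"] D(3) sub that unfolding E_def by blast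
    then have "g (min (\<pi> \<beta> (h \<alpha>)) (\<pi> \<beta> (h \<gamma>))) < max (\<pi> \<beta> (h \<alpha>)) (\<pi> \<beta> (h \<gamma>))"
      if "\<alpha> \<notin> E" "\<alpha> < \<beta>" "\<gamma> \<notin> E" "\<gamma> < \<beta>" "\<alpha> \<noteq> \<gamma>" for \<alpha> \<gamma>
      using cl that unfolding R_def closed_under_def not_le[symmetric] by blast
    moreover have "{..<\<beta>} - E \<inter> {..<\<beta>} = {..<\<beta>} - E" by blast
    ultimately show "almost_spread (\<pi> \<beta>) \<beta> g h"
      unfolding almost_spread_def by (intro exI[of _ "E \<inter> {..<\<beta>}"] conjI ballI impI) simp_all
  qed
qed

lemma club_next:
  assumes "club C"
  shows "(LEAST e. e \<in> C \<and> i < e) \<in> C" "i < (LEAST e. e \<in> C \<and> i < e)"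
proof -
  have "\<exists>e. e \<in> C \<and> i < e" using assms unfolding club_def by blast
  from LeastI_ex[OF this]
  show "(LEAST e. e \<in> C \<and> i < e) \<in> C" "i < (LEAST e. e \<in> C \<and> i < e)" by auto
qed

text \<open>Let \<open>g C i\<close> be the next element of C after i. If two points x < y are far
  apart for \<open>g C\<close>, then C has an element strictly between them, so limits of such
  points belong to C.\<close>

lemma star_star_imp_A:
  assumes star: statement_star_star
  shows statement_A
  unfolding statement_A_def
proof (intro allI impI)
  fix \<C> :: "omega1 set set"
  assume \<C>: "|\<C>| \<le>o aleph2 \<and> (\<forall>C\<in>\<C>. club C)"
  obtain \<pi> :: "omega2 \<Rightarrow> omega2 \<Rightarrow> omega1"
    where \<pi>: "\<And>\<beta>. w1 \<le> \<beta> \<Longrightarrow> bij_betw (\<pi> \<beta>) {..<\<beta>} UNIV"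
    using bij_lessThan_omega2_omega1 by metis
  define g where "g C i = (LEAST e. e \<in> C \<and> i < e)" for C and i :: omega1
  have g: "g C i \<in> C" "i < g C i" if "C \<in> \<C>" for C i
    using club_next[of C i] \<C> that unfolding g_def by auto
  have "|g ` \<C>| \<le>o aleph2" using \<C> ordLeq_transitive[OF card_of_image] by blast
  from star_star_spread[OF star \<pi> this] obtain h where h: "inj h"
    "\<And>C \<beta>. C \<in> \<C> \<Longrightarrow> w1 \<le> \<beta> \<Longrightarrow> closed_under \<beta> h \<Longrightarrow> almost_spread (\<pi> \<beta>) \<beta> (g C) h"
    by blast
  obtain \<beta> where "\<beta> \<in> S21" and cl: "closed_under \<beta> h"
    using S21_closed_point[of "\<lambda>x. {h x}"] unfolding closed_under_def by auto
  then have \<beta>: "w1 \<le> \<beta>" "uncountable {..<\<beta>}" by (simp_all add: S21_w1_le S21_uncountable)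
  define X where "X = (\<lambda>\<alpha>. \<pi> \<beta> (h \<alpha>)) ` {..<\<beta>}"
  have inj: "inj_on (\<lambda>\<alpha>. \<pi> \<beta> (h \<alpha>)) {..<\<beta>}"
    using \<pi>[OF \<beta>(1)] h(1) cl
    by (auto simp: inj_on_def inj_def bij_betw_def closed_under_def)
  have "uncountable X" unfolding X_def using \<beta>(2) inj countable_image_inj_on by blast
  define E where "E = {\<delta>. {..<\<delta>} \<noteq> {} \<and> (\<forall>\<alpha><\<delta>. \<exists>x\<in>X. \<alpha> < x \<and> x < \<delta>)}"
  have "club E" unfolding E_def by (rule club_limit_points_omega1) fact
  moreover have "countable (E - C)" if C: "C \<in> \<C>" for C
  proof -
    obtain D where "countable D" "\<forall>\<alpha>\<in>{..<\<beta>} - D. \<forall>\<gamma>\<in>{..<\<beta>} - D. \<alpha> \<noteq> \<gamma> \<longrightarrow>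
        g C (min (\<pi> \<beta> (h \<alpha>)) (\<pi> \<beta> (h \<gamma>))) < max (\<pi> \<beta> (h \<alpha>)) (\<pi> \<beta> (h \<gamma>))"
      using h(2)[OF C \<beta>(1) cl] unfolding almost_spread_def by (elim exE conjE)
    then have D: "countable D"
       "\<And>\<alpha> \<gamma>. \<alpha> < \<beta> \<Longrightarrow> \<alpha> \<notin> D \<Longrightarrow> \<gamma> < \<beta> \<Longrightarrow> \<gamma> \<notin> D \<Longrightarrow> \<alpha> \<noteq> \<gamma> \<Longrightarrow>
          g C (min (\<pi> \<beta> (h \<alpha>)) (\<pi> \<beta> (h \<gamma>))) < max (\<pi> \<beta> (h \<alpha>)) (\<pi> \<beta> (h \<gamma>))"
      by simp_all
    obtain b where b: "\<forall>x\<in>(\<lambda>\<alpha>. \<pi> \<beta> (h \<alpha>)) ` D. x < b"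
      using countable_bounded_omega1[OF countable_image[OF D(1)]] by blast
    \<comment> \<open>Beyond \<open>b\<close> no point of \<open>X\<close> comes from the
      exceptional set \<open>D\<close>.\<close>
    have gap: "g C x < y" if xy: "x \<in> X" "y \<in> X" "b < x" "x < y" for x y
    proof -
      obtain \<alpha> \<gamma> where "\<alpha> < \<beta>" "\<gamma> < \<beta>" and eq: "x = \<pi> \<beta> (h \<alpha>)" "y = \<pi> \<beta> (h \<gamma>)"
        using xy unfolding X_def by auto
      moreover have "\<alpha> \<notin> D" "\<gamma> \<notin> D" "\<alpha> \<noteq> \<gamma>" using b xy(3,4) unfolding eq by fastforce+
      ultimately show ?thesis
        using D(2)[of \<alpha> \<gamma>] xy(4) by (simp add: min_absorb1 max_absorb2 less_imp_le)
    qed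
    have "\<delta> \<in> C" if \<delta>: "\<delta> \<in> E" "b < \<delta>" for \<delta>
    proof -
      \<comment> \<open>Two successive points x < y of \<open>X\<close> are chosen between
        \<open>max \<alpha> b\<close> and \<delta>; the witness \<open>g C x\<close> is then trapped
        below y.\<close>
      have "\<exists>c\<in>C. \<alpha> < c \<and> c < \<delta>" if "\<alpha> < \<delta>" for \<alpha>
      proof -
        have "max \<alpha> b < \<delta>" using \<delta>(2) that by simp
        then obtain x where x: "x \<in> X" "max \<alpha> b < x" "x < \<delta>"
          using \<delta>(1) unfolding E_def by blast
        obtain y where "y \<in> X" "x < y" "y < \<delta>" using \<delta>(1) x(3) unfolding E_def by blast
        then have "g C x < \<delta>" using gap[of x y] x by auto
        moreover have "\<alpha> < g C x" using g(2)[OF C, of x] x(2) by (auto intro: less_trans)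
        ultimately show ?thesis using g(1)[OF C] by blast
      qed
      then show ?thesis using \<C> C \<delta>(1) unfolding club_def E_def by blast
    qed
    then have "E - C \<subseteq> {..b}" by (auto simp: not_less[symmetric])
    then show ?thesis using countable_subset[OF _ countable_atMost_omega1] by simp
  qed
  ultimately show "\<exists>E. club E \<and> (\<forall>C\<in>\<C>. countable (E - C))" by blast
qed

text \<open>Any choice of bijections works, since h is spread at every \<beta> in \<open>S21\<close>
  closed under h, and these \<beta> form a stationary set.\<close>

lemma star_star_imp_B:
  assumes star: statement_star_star
  shows statement_B
proof -
  obtain \<pi> :: "omega2 \<Rightarrow> omega2 \<Rightarrow> omega1"
    where \<pi>: "\<And>\<beta>. w1 \<le> \<beta> \<Longrightarrow> bij_betw (\<pi> \<beta>) {..<\<beta>} UNIV"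
    using bij_lessThan_omega2_omega1 by metis
  show ?thesis
    unfolding statement_B_def almost_spread_def[symmetric]
  proof (intro exI[of _ \<pi>] conjI allI impI \<pi>)
    fix g :: "omega1 \<Rightarrow> omega1"
    have "|{g}| \<le>o aleph2"
      by (simp add: countable_ordLeq_aleph2)
    from star_star_spread[OF star \<pi> this] obtain h where h: "inj h"
      "\<And>\<beta>. w1 \<le> \<beta> \<Longrightarrow> closed_under \<beta> h \<Longrightarrow> almost_spread (\<pi> \<beta>) \<beta> g h"
      by blast
    show "\<exists>h I. inj h \<and> stationary I \<and> I \<subseteq> S21 \<and> (\<forall>\<beta>\<in>I. closed_under \<beta> h) \<and>
        (\<forall>\<beta>\<in>I. almost_spread (\<pi> \<beta>) \<beta> g h)"
      by (intro exI[of _ h] exI[of _ "{\<beta>\<in>S21. closed_under \<beta> h}"])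
        (simp add: h S21_w1_le stationary_closed_S21)
  qed
qed

section \<open>From (A) and (B) to \<open>( ** )\<close>\<close>

text \<open>Apply (A) to the clubs of ordinals closed under f, and let \<open>g i\<close> be the
  next element of the resulting \<open>E\<close> after i. From some point on \<open>g i\<close> is
  closed under f and above i, hence above \<open>f i\<close>.\<close>

lemma A_imp_dominating:
  assumes A: statement_A and G: "|G :: (omega1 \<Rightarrow> omega1) set| \<le>o aleph2"
  shows "\<exists>g. \<forall>f\<in>G. \<exists>b. \<forall>i\<ge>b. f i < g i"
proof -
  define K where "K f = {\<delta>. closed_under \<delta> f}" for f :: "omega1 \<Rightarrow> omega1"
  have "|K ` G| \<le>o aleph2" using G ordLeq_transitive[OF card_of_image] by blast
  moreover have "\<forall>C\<in>K ` G. club C" unfolding K_def by (auto simp: club_closed_under_omega1)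
  ultimately obtain E where E: "club E" "\<And>f. f \<in> G \<Longrightarrow> countable (E - K f)"
    using A unfolding statement_A_def by (metis imageI)
  define g where "g i = (LEAST e. e \<in> E \<and> i < e)" for i
  have g: "g i \<in> E" "i < g i" for i using club_next[OF E(1)] unfolding g_def by auto
  have "\<exists>b. \<forall>i\<ge>b. f i < g i" if f: "f \<in> G" for f
  proof -
    obtain b where b: "\<forall>e\<in>E - K f. e < b" using countable_bounded_omega1 E(2)[OF f] by blast
    have "f i < g i" if "b \<le> i" for i
    proof -
      have "g i \<in> K f" using b g[of i] that by (meson DiffI le_less_trans less_asym)
      then show ?thesis using g(2) unfolding K_def closed_under_def by blast
    qed
    then show ?thesis by blast
  qed
  then show ?thesis by blast
qed

text \<open>If i \<le> j, then j \<le> \<open>\<phi> i\<close> < \<open>g i\<close> < j; the other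
  case is symmetric. Both bounds by \<phi> are assumed because the order of i and j is not known in
  the application.\<close>

lemma spread_points_avoid:
  fixes i j :: "'a::linorder"
  assumes "g (min i j) < max i j" "j \<le> \<phi> i" "i \<le> \<phi> j" "\<phi> i < g i" "\<phi> j < g j"
  shows False
  using assms by (cases "i \<le> j") (auto simp: min_def max_def)

lemma A_B_imp_star_star:
  assumes A: statement_A and B: statement_B
  shows statement_star_star
  unfolding statement_star_star_def
proof (intro allI impI)
  fix \<F> :: "(omega2 \<Rightarrow> omega2) set"
  assume \<F>: "|\<F>| \<le>o aleph2 \<and> (\<forall>f\<in>\<F>. inj f)"
  obtain \<pi> :: "omega2 \<Rightarrow> omega2 \<Rightarrow> omega1"
    where \<pi>: "\<And>\<beta>. w1 \<le> \<beta> \<Longrightarrow> bij_betw (\<pi> \<beta>) {..<\<beta>} UNIV"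
    and \<pi>B: "\<And>g. \<exists>h I. inj h \<and> stationary I \<and> I \<subseteq> S21 \<and> (\<forall>\<beta>\<in>I. closed_under \<beta> h) \<and>
        (\<forall>\<beta>\<in>I. almost_spread (\<pi> \<beta>) \<beta> g h)"
    using B unfolding statement_B_def almost_spread_def[symmetric] by blast
  define q where "q \<beta> = inv_into {..<\<beta>} (\<pi> \<beta>)" for \<beta>
  \<comment> \<open>The maximum bounds the actions of f and of its inverse, both transported to
    \<open>omega1\<close> along \<open>\<pi> \<beta>\<close>.\<close>
  define \<phi> where "\<phi> = (\<lambda>(f, \<beta>) i. max (\<pi> \<beta> (f (q \<beta> i))) (\<pi> \<beta> (inv f (q \<beta> i))))"
  have "|\<F> \<times> (UNIV :: omega2 set)| \<le>o aleph2"
    using \<F> by (intro card_of_Times_ordLeq_infinite_Field aleph2_infinite aleph2_Card_order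
        ordIso_imp_ordLeq[OF card_omega2]) blast
  then have "|\<phi> ` (\<F> \<times> UNIV)| \<le>o aleph2" by (rule ordLeq_transitive[OF card_of_image])
  from A_imp_dominating[OF A this] obtain g where
    g: "\<And>f \<beta>. f \<in> \<F> \<Longrightarrow> \<exists>b. \<forall>i\<ge>b. \<phi> (f, \<beta>) i < g i" by blast
  obtain h I where h: "inj h" "stationary I" "I \<subseteq> S21" "\<And>\<beta>. \<beta> \<in> I \<Longrightarrow> closed_under \<beta> h"
    and spread: "\<And>\<beta>. \<beta> \<in> I \<Longrightarrow> almost_spread (\<pi> \<beta>) \<beta> g h"
    using \<pi>B[of g] by (elim exE conjE) blast
  have "\<exists>D. countable D \<and> (\<forall>\<alpha>\<in>- D. f \<alpha> \<noteq> h \<alpha>) \<and>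
      (\<forall>\<alpha>\<in>- D. \<forall>\<beta>\<in>- D. \<alpha> \<noteq> \<beta> \<longrightarrow> f (h \<alpha>) \<noteq> h \<beta>)" if f: "f \<in> \<F>" for f
  proof -
    have injf: "inj f" using \<F> f by blast
    \<comment> \<open>The second clause of \<open>( ** )\<close> concerns pairs, but removing the
      first point \<alpha> of each bad pair is enough.\<close>
    define X where "X = {\<alpha>. f \<alpha> = h \<alpha> \<or> (\<exists>\<gamma>. \<gamma> \<noteq> \<alpha> \<and> f (h \<alpha>) = h \<gamma>)}"
    have "countable X"
    proof (rule countable_omega2_if_locally_countable)
      fix b
      \<comment> \<open>The stationary set \<open>I\<close> meets this club. Membership of the
        constant b in the sets yields b < \<beta>, so such \<beta> are cofinal.\<close>
      have "club {\<delta>. \<forall>x<\<delta>. {b, f x, inv f x, inv h x} \<subseteq> {..<\<delta>}}"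
        by (rule club_closed_under_setvalued_omega2) simp
      then obtain \<beta> where \<beta>: "\<beta> \<in> I" and cl: "\<forall>x<\<beta>. {b, f x, inv f x, inv h x} \<subseteq> {..<\<beta>}"
        using h(2) unfolding stationary_def by blast
      have S: "\<beta> \<in> S21" using \<beta> h(3) by blast
      then have "b < \<beta>" using cl S21_nonempty by blast
      have bij: "bij_betw (\<pi> \<beta>) {..<\<beta>} UNIV" using \<pi> S21_w1_le S by blast
      have q\<pi>: "q \<beta> (\<pi> \<beta> x) = x" if "x < \<beta>" for x
        using bij that unfolding q_def by (simp add: bij_betw_def)
      have hcl: "h x < \<beta>" if "x < \<beta>" for x using h(4)[OF \<beta>] that unfolding closed_under_def by blast
      obtain c where c: "\<And>i. c \<le> i \<Longrightarrow> \<phi> (f, \<beta>) i < g i" using g[OF f] by blast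
      \<comment> \<open>Once both indices are at least \<open>c\<close>, where g dominates
        \<open>\<phi> (f, \<beta>)\<close>, a point and its image under f are too close to be
        spread.\<close>
      have avoid: False
        if xy: "x < \<beta>" "f x = y" "g (min (\<pi> \<beta> x) (\<pi> \<beta> y)) < max (\<pi> \<beta> x) (\<pi> \<beta> y)"
          "c \<le> \<pi> \<beta> x" "c \<le> \<pi> \<beta> y" for x y
      proof (rule spread_points_avoid[where \<phi> = "\<phi> (f, \<beta>)" and g = g, OF xy(3)])
        have "y < \<beta>" using cl xy(1,2) by blast
        have "inv f y = x" using inv_f_f[OF injf, of x] xy(2) by simp
        show "\<pi> \<beta> y \<le> \<phi> (f, \<beta>) (\<pi> \<beta> x)"
          using q\<pi>[OF xy(1)] xy(2) unfolding \<phi>_def by simp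
        show "\<pi> \<beta> x \<le> \<phi> (f, \<beta>) (\<pi> \<beta> y)"
          using q\<pi>[OF \<open>y < \<beta>\<close>] \<open>inv f y = x\<close> unfolding \<phi>_def by simp
      qed (use c xy(4,5) in auto)
      obtain D where "countable D"
        "\<forall>\<alpha>\<in>{..<\<beta>} - D. g (min (\<pi> \<beta> \<alpha>) (\<pi> \<beta> (h \<alpha>))) < max (\<pi> \<beta> \<alpha>) (\<pi> \<beta> (h \<alpha>))"
        "\<forall>\<alpha>\<in>{..<\<beta>} - D. \<forall>\<gamma>\<in>{..<\<beta>} - D. \<alpha> \<noteq> \<gamma> \<longrightarrow>
           g (min (\<pi> \<beta> (h \<alpha>)) (\<pi> \<beta> (h \<gamma>))) < max (\<pi> \<beta> (h \<alpha>)) (\<pi> \<beta> (h \<gamma>))"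
        using spread[OF \<beta>] unfolding almost_spread_def by (elim exE conjE)
      then have D: "countable D"
        "\<And>\<alpha>. \<alpha> < \<beta> \<Longrightarrow> \<alpha> \<notin> D \<Longrightarrow>
           g (min (\<pi> \<beta> \<alpha>) (\<pi> \<beta> (h \<alpha>))) < max (\<pi> \<beta> \<alpha>) (\<pi> \<beta> (h \<alpha>))"
        "\<And>\<alpha> \<gamma>. \<alpha> < \<beta> \<Longrightarrow> \<alpha> \<notin> D \<Longrightarrow> \<gamma> < \<beta> \<Longrightarrow> \<gamma> \<notin> D \<Longrightarrow> \<alpha> \<noteq> \<gamma> \<Longrightarrow>
           g (min (\<pi> \<beta> (h \<alpha>)) (\<pi> \<beta> (h \<gamma>))) < max (\<pi> \<beta> (h \<alpha>)) (\<pi> \<beta> (h \<gamma>))"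
        by simp_all
      define T where "T = {x. x < \<beta> \<and> \<pi> \<beta> x < c}"
      \<comment> \<open>Outside \<open>D'\<close> both \<alpha> and \<open>h \<alpha>\<close> have
        index at least \<open>c\<close>. The preimage of \<open>T\<close> is countable because h is
        injective.\<close>
      define D' where "D' = D \<union> T \<union> h -` T"
      have "countable T" unfolding T_def by (rule countable_vimage_initial_segment[OF bij])
      then have "countable (h -` T)"
        using countable_image_inj_on[OF countable_subset[OF image_vimage_subset]]
          inj_on_subset[OF h(1) subset_UNIV] by blast
      then have D': "countable D'"
        unfolding D'_def using D(1) \<open>countable T\<close> by simp
      \<comment> \<open>For \<alpha> in \<open>X\<close> outside \<open>D'\<close>,
        \<open>avoid\<close> excludes \<open>f \<alpha> = h \<alpha>\<close>, so
        \<open>f (h \<alpha>) = h \<gamma>\<close> for some \<gamma> \<noteq> \<alpha>. By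
        \<open>avoid\<close> again \<gamma> lies in \<open>D'\<close>, and \<alpha> is recovered
        from \<gamma> through the inverses.\<close>
      have "X \<inter> {..<\<beta>} \<subseteq> D' \<union> (\<lambda>\<gamma>. inv h (inv f (h \<gamma>))) ` D'"
      proof
        fix \<alpha> assume "\<alpha> \<in> X \<inter> {..<\<beta>}"
        then have \<alpha>: "\<alpha> < \<beta>" "\<alpha> \<in> X" by auto
        have "\<alpha> \<in> (\<lambda>\<gamma>. inv h (inv f (h \<gamma>))) ` D'" if "\<alpha> \<notin> D'"
        proof -
          have big: "c \<le> \<pi> \<beta> x" "c \<le> \<pi> \<beta> (h x)" "x \<notin> D" if "x < \<beta>" "x \<notin> D'" for x
            using that hcl[of x] unfolding D'_def T_def by (auto simp: not_less)
          have "f \<alpha> \<noteq> h \<alpha>" using avoid[of \<alpha> "h \<alpha>"] big[OF \<alpha>(1) that] D(2) \<alpha>(1) by blast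
          then obtain \<gamma> where \<gamma>: "\<gamma> \<noteq> \<alpha>" "f (h \<alpha>) = h \<gamma>" using \<alpha>(2) unfolding X_def by blast
          have "\<gamma> = inv h (f (h \<alpha>))" using \<gamma>(2) h(1) by simp
          then have \<gamma>\<beta>: "\<gamma> < \<beta>" using cl hcl \<alpha>(1) by blast
          have "\<gamma> \<in> D'"
            using avoid[of "h \<alpha>" "h \<gamma>"] big[OF \<alpha>(1) that] big[OF \<gamma>\<beta>] D(3)[of \<alpha> \<gamma>] \<alpha>(1) \<gamma> \<gamma>\<beta> hcl
            by blast
          moreover have "\<alpha> = inv h (inv f (h \<gamma>))" using \<gamma>(2) h(1) injf by (metis inv_f_f)
          ultimately show ?thesis by blast
        qed
        then show "\<alpha> \<in> D' \<union> (\<lambda>\<gamma>. inv h (inv f (h \<gamma>))) ` D'" by blast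
      qed
      then have "countable (X \<inter> {..<\<beta>})" by (rule countable_subset) (use D' in simp)
      then show "\<exists>\<beta>>b. countable (X \<inter> {..<\<beta>})" using \<open>b < \<beta>\<close> by blast
    qed
    moreover have "f \<alpha> \<noteq> h \<alpha>" if "\<alpha> \<in> - X" for \<alpha>
      using that unfolding X_def by blast
    moreover have "f (h \<alpha>) \<noteq> h \<beta>" if "\<alpha> \<in> - X" "\<alpha> \<noteq> \<beta>" for \<alpha> \<beta>
      using that unfolding X_def by (metis (mono_tags, lifting) ComplD mem_Collect_eq)
    ultimately show ?thesis by (intro exI[of _ X] conjI ballI impI) simp_all
  qed
  then show "\<exists>h. inj h \<and> (\<forall>f\<in>\<F>. \<exists>D. countable D \<and> (\<forall>\<alpha>\<in>- D. f \<alpha> \<noteq> h \<alpha>) \<and>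
      (\<forall>\<alpha>\<in>- D. \<forall>\<beta>\<in>- D. \<alpha> \<noteq> \<beta> \<longrightarrow> f (h \<alpha>) \<noteq> h \<beta>))"
    using h(1) by blast
qed

theorem lemma2p6:
  shows "statement_A \<and> statement_B \<longleftrightarrow> statement_star_star"
  using A_B_imp_star_star star_star_imp_A star_star_imp_B by blast

end
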